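(* Let $X$ be an infinite dimensional uniformly smooth real Banach space. Then $K_a(X)>1$.
   Context: For a Banach space $X$, $B_X$ denotes its closed unit ball and $X^*$ its dual. For positive constants $c_1,c_2,d$, a subset $S$ of a normed space $X$ is called a $(c_1,c_2,d)$-b.s.a. (bounded and separated antipodal) subset of $X$ if (1) $\|x\|\le c_1$ for all $x\in S$, and (2) for every $x,y\in S$ with $x\ne y$ there exists $f\in X^*$ with $\|f\|\le c_2$ such that $d\le f(y)-f(x)$ and $f(x)\le f(z)\le f(y)$ for all $z\in S$. For an infinite dimensional Banach space $X$, $$K_a(X)=\sup\{d>0:\ \text{there exists an infinite } S\subseteq B_X \text{ which is a } (1,1,d)\text{-b.s.a. subset of } X\}.$$ *)

theory Defs
  imports "HOL-Analysis.Analysis"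
begin

definition infinite_dimensional :: "'a::real_vector itself \<Rightarrow> bool" where
  "infinite_dimensional _ \<longleftrightarrow> (\<nexists>B :: 'a set. finite B \<and> span B = UNIV)"

text \<open>The modulus of smoothness. For \<open>t \<ge> 0\<close> the set is bounded above by \<open>t\<close>,
  and it is nonempty as soon as the space is nonzero, so the real supremum is the genuine one.\<close>
definition smoothness_modulus :: "'a::real_normed_vector itself \<Rightarrow> real \<Rightarrow> real" where
  "smoothness_modulus _ t =
     Sup {(norm (x + t *\<^sub>R y) + norm (x - t *\<^sub>R y)) / 2 - 1 | x y :: 'a. norm x = 1 \<and> norm y = 1}"

definition uniformly_smooth :: "'a::real_normed_vector itself \<Rightarrow> bool" where
  "uniformly_smooth X \<longleftrightarrow> ((\<lambda>t. smoothness_modulus X t / t) \<longlongrightarrow> 0) (at_right 0)"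

text \<open>The dual of \<open>'a\<close> is the space \<open>'a \<Rightarrow>\<^sub>L real\<close> with its operator norm.\<close>
definition bsa :: "real \<Rightarrow> real \<Rightarrow> real \<Rightarrow> 'a::real_normed_vector set \<Rightarrow> bool" where
  "bsa c1 c2 d S \<longleftrightarrow>
     (\<forall>x\<in>S. norm x \<le> c1) \<and>
     (\<forall>x\<in>S. \<forall>y\<in>S. x \<noteq> y \<longrightarrow>
        (\<exists>f :: 'a \<Rightarrow>\<^sub>L real. norm f \<le> c2 \<and>
           d \<le> blinfun_apply f y - blinfun_apply f x \<and>
           (\<forall>z\<in>S. blinfun_apply f x \<le> blinfun_apply f z \<and> blinfun_apply f z \<le> blinfun_apply f y)))"

text \<open>The supremum is taken in the extended reals, so that it is meaningful without first showing
  that the set of admissible \<open>d\<close> is nonempty (it is always bounded above by 2).\<close>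
definition K_a :: "'a::banach itself \<Rightarrow> ereal" where
  "K_a _ = (SUP d \<in> {d :: real. d > 0 \<and> (\<exists>S :: 'a set. infinite S \<and> S \<subseteq> cball 0 1 \<and> bsa 1 1 d S)}. ereal d)"

end

theory Submission
  imports Defs "HOL-Library.Ramsey"
begin

text \<open>
  Suppose unit vectors \<open>e\<^sub>n\<close> and functionals \<open>f\<^sub>n\<close> of norm at most \<open>1\<close> satisfy \<open>f\<^sub>n(e\<^sub>n) = 1\<close> and
  \<open>\<bar>f\<^sub>m(e\<^sub>n)\<bar> \<le> \<epsilon>\<close> for \<open>m \<noteq> n\<close>. Then \<open>f\<^sub>n - f\<^sub>m\<close> is about \<open>1\<close> at \<open>e\<^sub>n\<close>, about \<open>-1\<close> at \<open>e\<^sub>m\<close> and about \<open>0\<close> at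
  every other \<open>e\<^sub>k\<close>, so the set of all \<open>e\<^sub>n\<close> is antipodal; after division by \<open>2\<close> it witnesses only
  constants close to \<open>1\<close>. The gain comes from the dual: uniform smoothness of the space makes its
  dual uniformly convex (\<open>dual_convexity_inequality\<close>). As \<open>f\<^sub>n + f\<^sub>m\<close> is about \<open>1\<close> at \<open>e\<^sub>n\<close>, the
  functionals \<open>f\<^sub>n\<close> and \<open>-f\<^sub>m\<close> stay far apart, hence the norm of \<open>f\<^sub>n - f\<^sub>m\<close> is at most \<open>2 - \<delta>\<close>, where
  \<open>\<delta>\<close> depends on the space only. With \<open>\<epsilon>\<close> small against \<open>\<delta>\<close>, dividing by \<open>2 - \<delta>\<close> yields the constant
  \<open>(2 - 2\<epsilon>) / (2 - \<delta>) > 1\<close>.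

  To find such a system (\<open>exists_almost_biorthogonal_system\<close>), choose each \<open>e\<^sub>n\<close> in the common kernel of
  the norming functionals \<open>f\<^sub>m\<close> of the earlier vectors, which is nonzero in infinite dimension. This
  gives \<open>f\<^sub>m(e\<^sub>n) = 0\<close> for \<open>m < n\<close>, but no control for \<open>m > n\<close>. By Ramsey's theorem a
  subsequence has either \<open>\<bar>f\<^sub>m(e\<^sub>n)\<bar> \<le> \<epsilon>\<close> throughout, as wanted, or, after possibly replacing every
  \<open>e\<^sub>n\<close> by \<open>-e\<^sub>n\<close>, \<open>f\<^sub>m(e\<^sub>n) \<ge> \<epsilon>\<close> for all \<open>m > n\<close>. The second case is James's obstruction to reflexivity
  and cannot occur (\<open>no_one_sided_triangular_array\<close>): uniform convexity of the dual produces a convex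
  combination \<open>G\<close> of finitely many \<open>f\<^sub>i\<close> and a convex combination \<open>H\<close> of arbitrarily late ones at
  distance less than \<open>\<epsilon>\<close>, while at a suitable \<open>e\<^sub>N\<close> in between \<open>G\<close> vanishes and \<open>H\<close> is at least \<open>\<epsilon>\<close>.
\<close>

section \<open>Norming functionals in a uniformly smooth space\<close>

text \<open>The form of uniform smoothness used throughout: one step \<open>t\<close>, freed from the supremum in the
  modulus.\<close>

lemma uniformly_smoothD:
  assumes "uniformly_smooth TYPE('a::real_normed_vector)" and "\<epsilon> > 0"
  obtains t where "t > 0"
    and "\<And>x y :: 'a::real_normed_vector. norm x = 1 \<Longrightarrow> norm y = 1 \<Longrightarrow>
           norm (x + t *\<^sub>R y) + norm (x - t *\<^sub>R y) \<le> 2 + \<epsilon> * t"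
proof -
  have "\<forall>\<^sub>F t in at_right 0. smoothness_modulus TYPE('a) t / t < \<epsilon> / 2"
    using assms by (intro order_tendstoD(2)) (auto simp: uniformly_smooth_def)
  moreover have "\<forall>\<^sub>F t in at_right 0. (0::real) < t"
    by (rule eventually_at_right_less)
  ultimately have "\<forall>\<^sub>F t in at_right 0. 0 < t \<and> smoothness_modulus TYPE('a) t / t < \<epsilon> / 2"
    by eventually_elim simp
  then obtain t :: real where t: "t > 0" "smoothness_modulus TYPE('a) t / t < \<epsilon> / 2"
    using eventually_happens[of _ "at_right (0::real)"] by (auto simp: trivial_limit_at_right_real)
  let ?A = "{(norm (x + t *\<^sub>R y) + norm (x - t *\<^sub>R y)) / 2 - 1 | x y :: 'a. norm x = 1 \<and> norm y = 1}"
  have bdd: "bdd_above ?A"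
  proof (rule bdd_aboveI[of _ t], clarify)
    fix x y :: 'a assume "norm x = 1" "norm y = 1"
    then show "(norm (x + t *\<^sub>R y) + norm (x - t *\<^sub>R y)) / 2 - 1 \<le> t"
      using t(1) norm_triangle_ineq[of x "t *\<^sub>R y"] norm_triangle_ineq4[of x "t *\<^sub>R y"]
      by (simp add: field_simps)
  qed
  show thesis
  proof (rule that[OF t(1)])
    fix x y :: 'a assume "norm x = 1" "norm y = 1"
    then have "(norm (x + t *\<^sub>R y) + norm (x - t *\<^sub>R y)) / 2 - 1 \<le> smoothness_modulus TYPE('a) t"
      unfolding smoothness_modulus_def by (intro cSup_upper bdd) blast
    also have "\<dots> \<le> \<epsilon> / 2 * t"
      using t by (simp add: field_simps)
    finally show "norm (x + t *\<^sub>R y) + norm (x - t *\<^sub>R y) \<le> 2 + \<epsilon> * t"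
      by (simp add: field_simps)
  qed
qed

text \<open>In a smooth space the functional can be written down: it is the derivative of the norm at \<open>x\<close>. By convexity the one-sided directional derivative is an infimum of difference
  quotients and is sublinear in the direction; smoothness makes it odd, and an odd sublinear
  function is linear.\<close>

lemma exists_norming_functional:
  fixes x :: "'a::real_normed_vector"
  assumes smooth: "uniformly_smooth TYPE('a)" and x: "norm x = 1"
  shows "\<exists>F :: 'a \<Rightarrow>\<^sub>L real. norm F \<le> 1 \<and> blinfun_apply F x = 1"
proof -
  define q where "q t y = (norm (x + t *\<^sub>R y) - 1) / t" for t y
  define p where "p y = (INF t\<in>{0<..}. q t y)" for y
  have q_lower: "- norm y \<le> q t y" if "t > 0" for t y
    using that x norm_triangle_ineq2[of x "- t *\<^sub>R y"] by (simp add: q_def field_simps)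
  have p_le: "p y \<le> q t y" if "t > 0" for t y
    unfolding p_def using that q_lower by (intro cINF_lower bdd_belowI2[of _ "- norm y"]) auto
  have p_greatest: "b \<le> p y" if "\<And>t. t > 0 \<Longrightarrow> b \<le> q t y" for b y
    unfolding p_def using that by (intro cINF_greatest) auto
  have p_upper: "p y \<le> norm y" for y
    using p_le[of 1 y] x norm_triangle_ineq[of x y] by (simp add: q_def)
  have p_zero: "p 0 = 0"
    using p_le[of 1 0] p_greatest[of 0 0] x by (simp add: q_def)
  have p_x: "p x = 1"
  proof (rule antisym)
    show "p x \<le> 1" using p_upper[of x] x by simp
    have "q t x = 1" if "t > 0" for t
    proof -
      have "x + t *\<^sub>R x = (1 + t) *\<^sub>R x" by (simp add: algebra_simps)
      then have "norm (x + t *\<^sub>R x) = 1 + t" using that x by simp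
      then show ?thesis using that by (simp add: q_def)
    qed
    then show "1 \<le> p x" by (intro p_greatest) simp
  qed
  have p_add_le: "p (y + z) \<le> p y + p z" for y z
  proof -
    have "p (y + z) \<le> q s y + q t z" if st: "s > 0" "t > 0" for s t
    proof -
      \<comment> \<open>The step \<open>u\<close> makes \<open>x + u (y + z)\<close> a convex combination of \<open>x + s y\<close> and \<open>x + t z\<close>.\<close>
      define u where "u = s * t / (s + t)"
      have u: "u > 0" using st by (simp add: u_def)
      have "x + u *\<^sub>R (y + z) = (t/(s+t)) *\<^sub>R (x + s *\<^sub>R y) + (s/(s+t)) *\<^sub>R (x + t *\<^sub>R z)"
      proof -
        have "(t/(s+t)) *\<^sub>R (x + s *\<^sub>R y) + (s/(s+t)) *\<^sub>R (x + t *\<^sub>R z)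
            = (t/(s+t) + s/(s+t)) *\<^sub>R x + u *\<^sub>R (y + z)"
          by (simp add: algebra_simps u_def)
        moreover have "t/(s+t) + s/(s+t) = 1" using st by (simp add: add_divide_distrib[symmetric] add.commute)
        ultimately show ?thesis by simp
      qed
      then have "norm (x + u *\<^sub>R (y + z))
          \<le> norm ((t/(s+t)) *\<^sub>R (x + s *\<^sub>R y)) + norm ((s/(s+t)) *\<^sub>R (x + t *\<^sub>R z))"
        by (simp only: norm_triangle_ineq)
      also have "\<dots> = t/(s+t) * norm (x + s *\<^sub>R y) + s/(s+t) * norm (x + t *\<^sub>R z)"
        using st by simp
      also have "\<dots> = 1 + u * (q s y + q t z)"
        using st by (simp add: q_def u_def divide_simps) (simp add: algebra_simps)
      finally have "q u (y + z) \<le> q s y + q t z"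
        using u by (simp add: q_def pos_divide_le_eq mult.commute)
      then show ?thesis using p_le[OF u] by (rule order_trans[rotated])
    qed
    then have "p (y + z) - q s y \<le> p z" if "s > 0" for s
      using that by (intro p_greatest) (simp add: diff_le_eq add.commute[of "q _ z"])
    then have "p (y + z) - p z \<le> p y"
      by (intro p_greatest) (simp add: diff_le_eq add.commute[of "p z"])
    then show ?thesis by simp
  qed
  have p_scale_ge: "c * p y \<le> p (c *\<^sub>R y)" if "c > 0" for c y
  proof (rule p_greatest)
    fix t :: real assume "t > 0"
    then have "c * p y \<le> c * q (c * t) y"
      using that by (intro mult_left_mono p_le) auto
    also have "\<dots> = q t (c *\<^sub>R y)"
      using that by (simp add: q_def mult.commute)
    finally show "c * p y \<le> q t (c *\<^sub>R y)" .
  qed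
  have p_scale_pos: "p (c *\<^sub>R y) = c * p y" if "c > 0" for c y
    using p_scale_ge[OF that, of y] p_scale_ge[of "1/c" "c *\<^sub>R y"] that
    by (simp add: field_simps)
  \<comment> \<open>This is where smoothness enters: the derivatives in opposite directions cancel.\<close>
  have p_unit: "p y + p (- y) \<le> 0" if y: "norm y = 1" for y
  proof (rule field_le_epsilon)
    fix e :: real assume "e > 0"
    obtain t where "t > 0" and "\<And>x y :: 'a. norm x = 1 \<Longrightarrow> norm y = 1 \<Longrightarrow>
        norm (x + t *\<^sub>R y) + norm (x - t *\<^sub>R y) \<le> 2 + e * t"
      using that by (rule uniformly_smoothD[OF smooth \<open>e > 0\<close>])
    then have t: "t > 0" "norm (x + t *\<^sub>R y) + norm (x - t *\<^sub>R y) \<le> 2 + e * t"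
      using x y by auto
    have "p y + p (- y) \<le> q t y + q t (- y)"
      using t by (intro add_mono p_le)
    also have "\<dots> = (norm (x + t *\<^sub>R y) + norm (x - t *\<^sub>R y) - 2) / t"
      by (simp add: q_def add_divide_distrib diff_divide_distrib)
    also have "\<dots> \<le> e"
      using t by (simp add: pos_divide_le_eq)
    finally show "p y + p (- y) \<le> 0 + e" by simp
  qed
  have p_minus: "p (- y) = - p y" for y
  proof (cases "y = 0")
    case False
    define u where "u = y /\<^sub>R norm y"
    have "norm u = 1" using False by (simp add: u_def)
    have "y = norm y *\<^sub>R u" using False by (simp add: u_def)
    then have "p y = norm y * p u" "p (- y) = norm y * p (- u)"
      using p_scale_pos[of "norm y" u] p_scale_pos[of "norm y" "- u"] False by auto
    then have "p y + p (- y) = norm y * (p u + p (- u))"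
      by (simp add: algebra_simps)
    also have "\<dots> \<le> 0"
      using p_unit[OF \<open>norm u = 1\<close>] by (simp add: mult_nonneg_nonpos)
    finally show ?thesis using p_add_le[of y "- y"] p_zero by simp
  qed (simp add: p_zero)
  have p_add: "p (y + z) = p y + p z" for y z
    using p_add_le[of y z] p_add_le[of "- y" "- z"] p_minus[of "y + z"] p_minus[of y] p_minus[of z]
    by simp
  have p_scale: "p (c *\<^sub>R y) = c * p y" for c y
    using p_scale_pos[of c y] p_scale_pos[of "- c" y] p_minus[of "c *\<^sub>R y"] p_zero
    by (cases "c = 0"; cases "c > 0") auto
  have p_abs: "\<bar>p y\<bar> \<le> norm y" for y
    using p_upper[of y] p_upper[of "- y"] p_minus[of y] by simp
  have lin: "bounded_linear p"
    by (rule bounded_linear_intro[of _ 1]) (auto simp: p_add p_scale p_abs)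
  have "norm (Blinfun p) \<le> 1"
    by (rule norm_blinfun_bound) (auto simp: bounded_linear_Blinfun_apply[OF lin] p_abs)
  then show ?thesis
    using p_x by (intro exI[of _ "Blinfun p"]) (simp add: bounded_linear_Blinfun_apply[OF lin])
qed

section \<open>A triangular system of vectors and functionals\<close>

text \<open>Each functional lowers the dimension by at most one: the kernel of \<open>f n\<close> in the preceding
  intersection, together with one vector outside it, spans that intersection.\<close>

lemma not_finitely_spanned_kernels:
  fixes f :: "nat \<Rightarrow> 'a::real_normed_vector \<Rightarrow>\<^sub>L real"
  assumes "infinite_dimensional TYPE('a)" and "finite B"
  shows "\<not> {x. \<forall>m<n. blinfun_apply (f m) x = 0} \<subseteq> span B"
  using assms(2)
proof (induction n arbitrary: B)
  case 0
  then show ?case using assms(1) by (auto simp: infinite_dimensional_def)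
next
  case (Suc n)
  let ?V = "{x. \<forall>m<n. blinfun_apply (f m) x = 0}"
  show ?case
  proof
    assume sub: "{x. \<forall>m<Suc n. blinfun_apply (f m) x = 0} \<subseteq> span B"
    show False
    proof (cases "\<exists>v\<in>?V. blinfun_apply (f n) v \<noteq> 0")
      case True
      then obtain v where v: "v \<in> ?V" "blinfun_apply (f n) v \<noteq> 0" by blast
      have "?V \<subseteq> span (insert v B)"
      proof
        fix x assume x: "x \<in> ?V"
        let ?c = "blinfun_apply (f n) x / blinfun_apply (f n) v"
        have "x - ?c *\<^sub>R v \<in> {x. \<forall>m<Suc n. blinfun_apply (f m) x = 0}"
          using x v by (auto simp: less_Suc_eq blinfun.diff_right blinfun.scaleR_right)
        then show "x \<in> span (insert v B)"
          using sub span_breakdown_eq by blast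
      qed
      then show False using Suc.IH[of "insert v B"] Suc.prems by blast
    next
      case False
      then have "?V \<subseteq> span B" using sub by (auto simp: less_Suc_eq)
      then show False using Suc.IH Suc.prems by blast
    qed
  qed
qed

lemma exists_triangular_system:
  assumes inf_dim: "infinite_dimensional TYPE('a::real_normed_vector)"
    and smooth: "uniformly_smooth TYPE('a::real_normed_vector)"
  obtains e :: "nat \<Rightarrow> 'a::real_normed_vector" and f :: "nat \<Rightarrow> 'a::real_normed_vector \<Rightarrow>\<^sub>L real"
  where "\<And>n. norm (e n) = 1" and "\<And>n. norm (f n) \<le> 1"
    and "\<And>n. blinfun_apply (f n) (e n) = 1"
    and "\<And>m n. m < n \<Longrightarrow> blinfun_apply (f m) (e n) = 0"
proof -
  obtain J :: "'a \<Rightarrow> 'a \<Rightarrow>\<^sub>L real"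
    where J: "\<And>x. norm x = 1 \<Longrightarrow> norm (J x) \<le> 1 \<and> blinfun_apply (J x) x = 1"
    using exists_norming_functional[OF smooth] by metis
  have step: "\<exists>v. norm v = 1 \<and> (\<forall>m<n. blinfun_apply (J (e m)) v = 0)"
    for e :: "nat \<Rightarrow> 'a" and n
  proof -
    obtain w where w: "\<forall>m<n. blinfun_apply (J (e m)) w = 0" "w \<noteq> 0"
      using not_finitely_spanned_kernels[OF inf_dim, of "{}" n "\<lambda>m. J (e m)"] by auto
    then show ?thesis
      by (intro exI[of _ "w /\<^sub>R norm w"]) (auto simp: blinfun.scaleR_right)
  qed
  have "\<exists>e :: nat \<Rightarrow> 'a. \<forall>n. norm (e n) = 1 \<and> (\<forall>m<n. blinfun_apply (J (e m)) (e n) = 0)"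
    by (rule dependent_wf_choice[of less_than
          "\<lambda>e n v. norm v = 1 \<and> (\<forall>m<n. blinfun_apply (J (e m)) v = 0)"]) (auto simp: step)
  then obtain e :: "nat \<Rightarrow> 'a" where "\<And>n. norm (e n) = 1" "\<And>m n. m < n \<Longrightarrow> blinfun_apply (J (e m)) (e n) = 0"
    by blast
  then show thesis using that[of e "\<lambda>n. J (e n)"] J by blast
qed

section \<open>Uniform convexity of the dual\<close>

text \<open>The sphere is symmetric, so a one-sided bound controls the norm. The unit vector \<open>u\<close> excludes the zero space, where the hypothesis would be vacuous and \<open>b\<close> could be negative.\<close>

lemma norm_blinfun_le_on_sphere:
  fixes A :: "'a::real_normed_vector \<Rightarrow>\<^sub>L real"
  assumes "norm (u::'a) = 1" and le: "\<And>x. norm x = 1 \<Longrightarrow> blinfun_apply A x \<le> b"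
  shows "norm A \<le> b"
proof (rule norm_blinfun_bound)
  have "blinfun_apply A (- u) \<le> b" "blinfun_apply A u \<le> b" using assms by auto
  then show "0 \<le> b" by (simp add: blinfun.minus_right)
  fix x :: 'a
  show "norm (blinfun_apply A x) \<le> b * norm x"
  proof (cases "x = 0")
    case False
    let ?v = "x /\<^sub>R norm x"
    have "norm ?v = 1" using False by simp
    then have "blinfun_apply A ?v \<le> b" "blinfun_apply A (- ?v) \<le> b" using le by auto
    then show ?thesis
      using False by (simp add: blinfun.minus_right blinfun.scaleR_right field_simps abs_le_iff)
  qed simp
qed

text \<open>Lindenstrauss's duality between smoothness and convexity: take the supremum over unit vectors
  \<open>x\<close> and \<open>y\<close> of \<open>(F + G)(x) + t (F - G)(y) = F(x + t y) + G(x - t y)\<close>. Two functionals that are far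
  apart thus have a sum of norm well below \<open>2 R\<close>.\<close>

lemma dual_convexity_inequality:
  fixes F G :: "'a::real_normed_vector \<Rightarrow>\<^sub>L real"
  assumes "t > 0" and u: "norm (u::'a) = 1"
    and smooth: "\<And>x y :: 'a. norm x = 1 \<Longrightarrow> norm y = 1 \<Longrightarrow>
           norm (x + t *\<^sub>R y) + norm (x - t *\<^sub>R y) \<le> 2 + \<epsilon> * t"
    and R: "norm F \<le> R" "norm G \<le> R"
  shows "norm (F + G) + t * norm (F - G) \<le> R * (2 + \<epsilon> * t)"
proof -
  have apply_le: "blinfun_apply H x \<le> R * norm x" if "norm H \<le> R" for H :: "'a \<Rightarrow>\<^sub>L real" and x
    using norm_blinfun[of H x] mult_right_mono[OF that norm_ge_zero[of x]] by simp
  have "0 \<le> R" using R(1) norm_ge_zero order_trans by blast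
  have *: "blinfun_apply (F + G) x + t * blinfun_apply (F - G) y \<le> R * (2 + \<epsilon> * t)"
    if "norm x = 1" "norm y = 1" for x y
  proof -
    have "blinfun_apply (F + G) x + t * blinfun_apply (F - G) y
        = blinfun_apply F (x + t *\<^sub>R y) + blinfun_apply G (x - t *\<^sub>R y)"
      by (simp add: blinfun.bilinear_simps algebra_simps)
    also have "\<dots> \<le> R * norm (x + t *\<^sub>R y) + R * norm (x - t *\<^sub>R y)"
      using R by (intro add_mono apply_le)
    also have "\<dots> \<le> R * (2 + \<epsilon> * t)"
      unfolding distrib_left[symmetric] using that \<open>0 \<le> R\<close> by (intro mult_left_mono smooth)
    finally show ?thesis .
  qed
  have "norm (F - G) \<le> (R * (2 + \<epsilon> * t) - norm (F + G)) / t"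
  proof (rule norm_blinfun_le_on_sphere[OF u])
    fix y :: 'a assume y: "norm y = 1"
    have "norm (F + G) \<le> R * (2 + \<epsilon> * t) - t * blinfun_apply (F - G) y"
      using *[OF _ y] by (intro norm_blinfun_le_on_sphere[OF u]) (simp add: le_diff_eq)
    then show "blinfun_apply (F - G) y \<le> (R * (2 + \<epsilon> * t) - norm (F + G)) / t"
      using \<open>t > 0\<close> by (simp add: pos_le_divide_eq algebra_simps)
  qed
  then show ?thesis using \<open>t > 0\<close> by (simp add: pos_le_divide_eq algebra_simps)
qed

section \<open>Almost biorthogonal systems\<close>

text \<open>The core of Smulian's theorem for a uniformly convex space. The minimal norms of the convex
  hulls of the tails increase to a limit \<open>s\<close>. If \<open>n\<close> is so late that the minimum is almost \<open>s\<close>, take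
  \<open>G\<close> almost minimal; for any later tail take \<open>H\<close> almost minimal in it. The midpoint of \<open>G\<close> and \<open>H\<close> lies
  in the hull of the tail from \<open>n\<close>, so its norm is almost \<open>s\<close> too, and uniform convexity forces \<open>G\<close>
  and \<open>H\<close> to be close.\<close>

lemma close_convex_combinations:
  fixes F :: "nat \<Rightarrow> 'a::real_normed_vector \<Rightarrow>\<^sub>L real"
  assumes smooth: "uniformly_smooth TYPE('a)" and u: "norm (u::'a) = 1"
    and F: "\<And>n. norm (F n) \<le> 1" and "\<epsilon> > 0"
  obtains G n where "G \<in> convex hull F ` {n..}"
    and "\<And>N. \<exists>H \<in> convex hull F ` {N..}. norm (G - H) < \<epsilon>"
proof -
  obtain t where t: "t > 0"
    and tsm: "\<And>x y :: 'a. norm x = 1 \<Longrightarrow> norm y = 1 \<Longrightarrow>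
           norm (x + t *\<^sub>R y) + norm (x - t *\<^sub>R y) \<le> 2 + \<epsilon> / 4 * t"
  proof -
    have "0 < \<epsilon> / 4" using \<open>\<epsilon> > 0\<close> by simp
    then show thesis using that by (rule uniformly_smoothD[OF smooth])
  qed
  define C where "C n = convex hull F ` {n..}" for n
  define r where "r n = (INF G\<in>C n. norm G)" for n
  define s where "s = (SUP n. r n)"
  \<comment> \<open>The tolerance in all approximations. The error terms at the end add up to
    \<open>4 * \<eta> + t * \<epsilon> / 2\<close>, which has to stay below \<open>t * \<epsilon>\<close>; the bound \<open>1\<close> makes \<open>s + \<eta>\<close> at most \<open>2\<close>.\<close>
  define \<eta> where "\<eta> = min 1 (t * \<epsilon> / 16)"
  have \<eta>: "\<eta> > 0" "\<eta> \<le> 1" "16 * \<eta> \<le> t * \<epsilon>"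
    using t \<open>\<epsilon> > 0\<close> by (auto simp: \<eta>_def)
  have FC: "F n \<in> C n" for n
    unfolding C_def by (intro hull_inc) auto
  have C_mono: "C m \<subseteq> C n" if "n \<le> m" for m n
    unfolding C_def using that by (intro hull_mono) auto
  have r_le: "r n \<le> norm G" if "G \<in> C n" for n G
    unfolding r_def using that by (intro cINF_lower bdd_belowI2[of _ 0]) auto
  have r_le_1: "r n \<le> 1" for n using r_le[OF FC[of n]] F[of n] by simp
  then have r_le_s: "r n \<le> s" for n
    unfolding s_def by (intro cSUP_upper bdd_aboveI2[of _ _ 1]) auto
  have s_le_1: "s \<le> 1" unfolding s_def using r_le_1 by (intro cSUP_least) auto
  have near: "\<exists>G\<in>C n. norm G < s + \<eta>" for n
  proof -
    have "r n < s + \<eta>" using r_le_s[of n] \<eta> by simp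
    then show ?thesis
      unfolding r_def using FC[of n] by (subst (asm) cINF_less_iff) (auto intro!: bdd_belowI2[of _ 0])
  qed
  obtain n where n: "s - \<eta> < r n"
    using \<eta>(1) r_le_1 less_cSUP_iff[of UNIV r "s - \<eta>", OF _ bdd_aboveI2[of _ _ 1]]
    by (auto simp: s_def)
  obtain G where G: "G \<in> C n" "norm G < s + \<eta>" using near by blast
  show thesis
  proof (rule that[of G n])
    show "G \<in> convex hull F ` {n..}" using G by (simp add: C_def)
    fix N
    obtain H where H: "H \<in> C (max n N)" "norm H < s + \<eta>" using near by blast
    then have HC: "H \<in> C n" "H \<in> C N" using C_mono[of n "max n N"] C_mono[of N "max n N"] by auto
    have "(1/2) *\<^sub>R G + (1/2) *\<^sub>R H \<in> C n"
      using G(1) HC(1) unfolding C_def by (intro convexD convex_convex_hull) auto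
    then have "s - \<eta> < norm ((1/2) *\<^sub>R (G + H))"
      using n r_le[of _ n] by (force simp: scaleR_add_right)
    then have mid: "2 * s - 2 * \<eta> < norm (G + H)" by simp
    have "norm (G + H) + t * norm (G - H) \<le> (s + \<eta>) * (2 + \<epsilon> / 4 * t)"
      by (rule dual_convexity_inequality[OF t u tsm]) (use G H in auto)
    also have "\<dots> = 2 * s + 2 * \<eta> + (s + \<eta>) * (t * \<epsilon> / 4)"
      by (simp add: algebra_simps)
    also have "\<dots> \<le> 2 * s + 2 * \<eta> + 2 * (t * \<epsilon> / 4)"
      using s_le_1 \<eta>(2) t \<open>\<epsilon> > 0\<close> by (intro add_left_mono mult_right_mono) auto
    finally have "t * norm (G - H) < 4 * \<eta> + t * \<epsilon> / 2"
      using mid by (simp add: mult.commute)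
    also have "\<dots> \<le> t * \<epsilon>" using \<eta>(1,3) by linarith
    finally have "norm (G - H) < \<epsilon>" using t by simp
    then show "\<exists>H \<in> convex hull F ` {N..}. norm (G - H) < \<epsilon>"
      using HC(2) by (auto simp: C_def)
  qed
qed

text \<open>A convex combination \<open>G\<close> of the \<open>F i\<close> vanishes at all late \<open>e n\<close>, because it involves finitely
  many \<open>F i\<close>, whereas combinations \<open>H\<close> of still later functionals are at least \<open>\<epsilon>\<close> there. So \<open>G\<close> and \<open>H\<close>
  could not be close.\<close>

lemma no_one_sided_triangular_array:
  fixes e :: "nat \<Rightarrow> 'a::real_normed_vector" and F :: "nat \<Rightarrow> 'a \<Rightarrow>\<^sub>L real"
  assumes smooth: "uniformly_smooth TYPE('a)"
    and e: "\<And>n. norm (e n) = 1" and F: "\<And>n. norm (F n) \<le> 1" and "\<epsilon> > 0"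
    and zero: "\<And>m n. m < n \<Longrightarrow> blinfun_apply (F m) (e n) = 0"
    and large: "\<And>m n. m < n \<Longrightarrow> \<epsilon> \<le> blinfun_apply (F n) (e m)"
  shows False
proof -
  obtain G n where G: "G \<in> convex hull F ` {n..}"
    and near: "\<And>N. \<exists>H \<in> convex hull F ` {N..}. norm (G - H) < \<epsilon>"
    using that by (rule close_convex_combinations[OF smooth e[of 0] F \<open>\<epsilon> > 0\<close>])
  have "convex {G :: 'a \<Rightarrow>\<^sub>L real. \<exists>N. \<forall>m>N. blinfun_apply G (e m) = 0}"
  proof (rule convexI, clarify)
    fix G H :: "'a \<Rightarrow>\<^sub>L real" and a b :: real and M N
    assume "\<forall>m>M. blinfun_apply G (e m) = 0" "\<forall>m>N. blinfun_apply H (e m) = 0"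
    then show "\<exists>N. \<forall>m>N. blinfun_apply (a *\<^sub>R G + b *\<^sub>R H) (e m) = 0"
      by (intro exI[of _ "max M N"]) (simp add: blinfun.bilinear_simps)
  qed
  then have "convex hull F ` {n..} \<subseteq> {G. \<exists>N. \<forall>m>N. blinfun_apply G (e m) = 0}"
    by (rule hull_minimal[rotated]) (use zero in blast)
  then obtain N where N: "blinfun_apply G (e (Suc N)) = 0" using G by blast
  obtain H where H: "H \<in> convex hull F ` {Suc (Suc N)..}" "norm (G - H) < \<epsilon>" using near by blast
  have "convex {H :: 'a \<Rightarrow>\<^sub>L real. \<epsilon> \<le> blinfun_apply H (e (Suc N))}"
    using convex_linear_vimage[of "\<lambda>H :: 'a \<Rightarrow>\<^sub>L real. blinfun_apply H (e (Suc N))" "{\<epsilon>..}"]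
    by (simp add: vimage_def linear_iff blinfun.bilinear_simps)
  then have "convex hull F ` {Suc (Suc N)..} \<subseteq> {H. \<epsilon> \<le> blinfun_apply H (e (Suc N))}"
    by (rule hull_minimal[rotated]) (auto intro: large)
  then have "\<epsilon> \<le> blinfun_apply H (e (Suc N))" using H by blast
  also have "\<dots> \<le> norm (blinfun_apply (G - H) (e (Suc N)))"
    using N by (simp add: blinfun.diff_left)
  also have "\<dots> \<le> norm (G - H)" using norm_blinfun[of "G - H" "e (Suc N)"] e by simp
  finally show False using H(2) by simp
qed

lemma exists_almost_biorthogonal_system:
  assumes inf_dim: "infinite_dimensional TYPE('a::real_normed_vector)"
    and smooth: "uniformly_smooth TYPE('a::real_normed_vector)" and "\<epsilon> > 0"
  obtains e :: "nat \<Rightarrow> 'a::real_normed_vector" and f :: "nat \<Rightarrow> 'a::real_normed_vector \<Rightarrow>\<^sub>L real"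
  where "\<And>n. norm (e n) = 1" and "\<And>n. norm (f n) \<le> 1"
    and "\<And>n. blinfun_apply (f n) (e n) = 1"
    and "\<And>m n. m \<noteq> n \<Longrightarrow> \<bar>blinfun_apply (f m) (e n)\<bar> \<le> \<epsilon>"
proof -
  obtain e :: "nat \<Rightarrow> 'a" and f :: "nat \<Rightarrow> 'a \<Rightarrow>\<^sub>L real"
    where e: "\<And>n. norm (e n) = 1" and f: "\<And>n. norm (f n) \<le> 1"
      and one: "\<And>n. blinfun_apply (f n) (e n) = 1"
      and zero: "\<And>m n. m < n \<Longrightarrow> blinfun_apply (f m) (e n) = 0"
    using that by (rule exists_triangular_system[OF inf_dim smooth])
  \<comment> \<open>Only the values of later functionals at earlier vectors are uncontrolled. They are small,
    large positive or large negative; Ramsey's theorem makes one of these cases uniform.\<close>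
  define colour :: "nat set \<Rightarrow> nat" where
    "colour P = (if \<bar>blinfun_apply (f (Max P)) (e (Min P))\<bar> \<le> \<epsilon> then 0
                 else if 0 < blinfun_apply (f (Max P)) (e (Min P)) then 1 else 2)" for P
  obtain Y c where Y: "infinite Y" and c: "c < 3"
    and hom: "\<And>m n. m \<in> Y \<Longrightarrow> n \<in> Y \<Longrightarrow> m \<noteq> n \<Longrightarrow> colour {m, n} = c"
  proof -
    have "\<forall>m\<in>UNIV. \<forall>n\<in>UNIV. m \<noteq> n \<longrightarrow> colour {m, n} < 3"
      by (simp add: colour_def)
    from Ramsey2[OF infinite_UNIV_nat this] show thesis using that by blast
  qed
  define k where "k = enumerate Y"
  have k: "k m < k n" if "m < n" for m n
    using that Y by (simp add: k_def enumerate_mono)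
  have kY: "k n \<in> Y" for n
    using Y by (simp add: k_def enumerate_in_set)
  have col: "c = (if \<bar>blinfun_apply (f (k n)) (e (k m))\<bar> \<le> \<epsilon> then 0
      else if 0 < blinfun_apply (f (k n)) (e (k m)) then 1 else 2)" if "m < n" for m n
  proof -
    have *: "Max {k m, k n} = k n" "Min {k m, k n} = k m" using k[OF that] by auto
    have "colour {k m, k n} = c" using k[OF that] by (intro hom kY) simp
    then show ?thesis unfolding colour_def * by (rule sym)
  qed
  have "c = 0"
  proof (rule ccontr)
    assume "c \<noteq> 0"
    then consider "c = 1" | "c = 2" using c by linarith
    then show False
    proof cases
      case 1
      show False
      proof (rule no_one_sided_triangular_array[OF smooth, of "\<lambda>n. e (k n)" "\<lambda>n. f (k n)" \<epsilon>])
        show "\<epsilon> \<le> blinfun_apply (f (k n)) (e (k m))" if "m < n" for m n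
          using col[OF that] 1 by (simp split: if_splits)
      qed (auto simp: e f zero k \<open>\<epsilon> > 0\<close>)
    next
      case 2
      \<comment> \<open>Changing the sign of every vector turns large negative values into large positive ones.\<close>
      show False
      proof (rule no_one_sided_triangular_array[OF smooth, of "\<lambda>n. - e (k n)" "\<lambda>n. f (k n)" \<epsilon>])
        show "\<epsilon> \<le> blinfun_apply (f (k n)) (- e (k m))" if "m < n" for m n
          using col[OF that] 2 by (simp add: blinfun.minus_right split: if_splits)
      qed (auto simp: e f zero k \<open>\<epsilon> > 0\<close> blinfun.minus_right)
    qed
  qed
  have small: "\<bar>blinfun_apply (f (k m)) (e (k n))\<bar> \<le> \<epsilon>" if "m \<noteq> n" for m n
  proof (cases "m < n")
    case True
    then show ?thesis using zero[OF k] \<open>\<epsilon> > 0\<close> by simp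
  next
    case False
    then have "n < m" using that by simp
    then show ?thesis
      using col[of n m] \<open>c = 0\<close> by (simp split: if_splits)
  qed
  show thesis
    by (rule that[of "\<lambda>n. e (k n)" "\<lambda>n. f (k n)"]) (auto simp: e f one small)
qed

section \<open>The antipodal set\<close>

theorem proposition1p4:
  assumes "infinite_dimensional TYPE('a::banach)"
    and "uniformly_smooth TYPE('a)"
  shows "K_a TYPE('a) > 1"
proof -
  obtain t where t: "t > 0"
    and tsm: "\<And>x y :: 'a. norm x = 1 \<Longrightarrow> norm y = 1 \<Longrightarrow>
           norm (x + t *\<^sub>R y) + norm (x - t *\<^sub>R y) \<le> 2 + 1 / 4 * t"
  proof -
    have "(0 :: real) < 1 / 4" by simp
    then show thesis using that by (rule uniformly_smoothD[OF assms(2)])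
  qed
  \<comment> \<open>Functionals of norm at most \<open>1\<close> at distance at least \<open>1 / 2\<close> have a sum of norm at most
    \<open>2 + t / 4 - t / 2 = 2 - t / 4\<close>. For \<open>2 - 2 * \<epsilon>\<close> to exceed this, \<open>\<epsilon>\<close> must be below \<open>t / 8\<close>; the
    bound \<open>1 / 4\<close> separates the values at \<open>e m\<close> and \<open>e n\<close> (at least \<open>1 - \<epsilon>\<close> in modulus) from the values
    at the other vectors (at most \<open>2 * \<epsilon>\<close>).\<close>
  define \<epsilon> where "\<epsilon> = min (1 / 4) (t / 16)"
  have \<epsilon>: "\<epsilon> > 0" "\<epsilon> \<le> 1 / 4" "16 * \<epsilon> \<le> t" using t by (auto simp: \<epsilon>_def)
  obtain e :: "nat \<Rightarrow> 'a" and f :: "nat \<Rightarrow> 'a \<Rightarrow>\<^sub>L real"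
    where e: "\<And>n. norm (e n) = 1" and f: "\<And>n. norm (f n) \<le> 1"
      and one: "\<And>n. blinfun_apply (f n) (e n) = 1"
      and small: "\<And>m n. m \<noteq> n \<Longrightarrow> \<bar>blinfun_apply (f m) (e n)\<bar> \<le> \<epsilon>"
    using that by (rule exists_almost_biorthogonal_system[OF assms \<epsilon>(1)])
  define L where "L = 2 - t / 4"
  \<comment> \<open>Uniform convexity of the dual, applied to \<open>f n\<close> and \<open>- f m\<close>.\<close>
  have diff_le: "norm (f n - f m) \<le> L" if "m \<noteq> n" for m n
  proof -
    have "1 - \<epsilon> \<le> blinfun_apply (f n - - f m) (e n)"
      using one[of n] small[OF that] by (simp add: blinfun.bilinear_simps abs_le_iff)
    also have "\<dots> \<le> norm (f n - - f m)"
      using norm_blinfun[of "f n - - f m" "e n"] e by simp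
    finally have "1 / 2 \<le> norm (f n - - f m)" using \<epsilon> by simp
    then have "t * (1 / 2) \<le> t * norm (f n - - f m)" using t by (intro mult_left_mono) auto
    moreover have "norm (f n + - f m) + t * norm (f n - - f m) \<le> 1 * (2 + 1 / 4 * t)"
      by (rule dual_convexity_inequality[OF t e[of 0] tsm]) (auto simp: f)
    ultimately show ?thesis by (simp add: L_def)
  qed
  have diff_ge: "2 - 2 * \<epsilon> \<le> blinfun_apply (f n - f m) (e n) - blinfun_apply (f n - f m) (e m)"
    if "m \<noteq> n" for m n
    using one[of n] one[of m] small[OF that] small[OF that[symmetric]]
    by (simp add: blinfun.bilinear_simps abs_le_iff)
  have "L > 0"
  proof -
    have "2 - 2 * \<epsilon> \<le> blinfun_apply (f 1 - f 0) (e 1 - e 0)"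
      using diff_ge[of 0 1] by (simp add: blinfun.diff_right)
    also have "\<dots> \<le> norm (f 1 - f 0) * norm (e 1 - e 0)"
      using norm_blinfun[of "f 1 - f 0" "e 1 - e 0"] by simp
    also have "\<dots> \<le> L * norm (e 1 - e 0)"
      by (intro mult_right_mono diff_le) auto
    finally have "0 < L * norm (e 1 - e 0)" using \<epsilon> by simp
    then show ?thesis by (simp add: zero_less_mult_iff)
  qed
  define d where "d = (2 - 2 * \<epsilon>) / L"
  have "d > 1" using \<open>L > 0\<close> \<epsilon> by (simp add: d_def L_def)
  have "inj e"
  proof (rule injI, rule ccontr)
    fix m n assume "e m = e n" "m \<noteq> n"
    then show False using one[of m] small[of m n] \<epsilon>(2) by simp
  qed
  have "bsa 1 1 d (range e)"
    unfolding bsa_def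
  proof (intro conjI ballI impI)
    fix x y assume "x \<in> range e" "y \<in> range e" "x \<noteq> y"
    then obtain m n where mn: "x = e m" "y = e n" "m \<noteq> n" by auto
    let ?g = "(f n - f m) /\<^sub>R L"
    have "norm ?g \<le> 1"
      using diff_le[OF mn(3)] \<open>L > 0\<close> by (simp only: norm_scaleR) (simp add: field_simps)
    moreover have "d \<le> blinfun_apply ?g y - blinfun_apply ?g x"
    proof -
      have "d \<le> (blinfun_apply (f n - f m) y - blinfun_apply (f n - f m) x) / L"
        unfolding d_def mn using diff_ge[OF mn(3)] \<open>L > 0\<close> by (intro divide_right_mono) auto
      also have "\<dots> = blinfun_apply ?g y - blinfun_apply ?g x"
        unfolding blinfun.scaleR_left by (simp add: divide_inverse_commute right_diff_distrib)
      finally show ?thesis .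
    qed
    moreover have "blinfun_apply ?g x \<le> blinfun_apply ?g z \<and> blinfun_apply ?g z \<le> blinfun_apply ?g y"
      if z: "z \<in> range e" for z
    proof -
      obtain k where k: "z = e k" using z by auto
      have "blinfun_apply (f n - f m) x \<le> blinfun_apply (f n - f m) z
          \<and> blinfun_apply (f n - f m) z \<le> blinfun_apply (f n - f m) y"
        using one[of n] one[of m] small[of m n] small[of n m] small[of n k] small[of m k] mn \<epsilon>(2)
        by (cases "k = n"; cases "k = m") (auto simp: k blinfun.diff_left abs_le_iff)
      then show ?thesis
        using \<open>L > 0\<close> by (auto simp: blinfun.scaleR_left intro!: mult_left_mono)
    qed
    ultimately show "\<exists>g :: 'a \<Rightarrow>\<^sub>L real. norm g \<le> 1 \<and> d \<le> blinfun_apply g y - blinfun_apply g x \<and>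
        (\<forall>z\<in>range e. blinfun_apply g x \<le> blinfun_apply g z \<and> blinfun_apply g z \<le> blinfun_apply g y)"
      by blast
  qed (auto simp: e)
  moreover have "infinite (range e)" using \<open>inj e\<close> finite_imageD by blast
  ultimately have "ereal d \<le> K_a TYPE('a)"
    unfolding K_a_def using \<open>d > 1\<close> e by (intro SUP_upper) auto
  moreover have "1 < ereal d" using \<open>d > 1\<close> by (simp add: one_ereal_def)
  ultimately show ?thesis by (rule less_le_trans[rotated])
qed

end
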